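(* Let $d\in\{2,3\}$, let $A,B,C,D$ be quantum systems each with Hilbert space $\mathbb{C}^d$, and let $|\phi\rangle_{AB}\in\mathbb{C}^d\otimes\mathbb{C}^d$ and $|\psi\rangle_{CD}\in\mathbb{C}^d\otimes\mathbb{C}^d$ be arbitrary pure states (unit vectors). Put $|\Phi\rangle_{ABCD}=|\phi\rangle_{AB}\otimes|\psi\rangle_{CD}$ and $\rho_{AC}=\mathrm{tr}_{BD}\,|\Phi\rangle_{ABCD}\langle\Phi|$. Then $$\mathcal{N}^a(\rho_{AC})\ \geq\ \mathcal{N}_c\left(|\phi\rangle_{AB}\right)\,\mathcal{N}_c\left(|\psi\rangle_{CD}\right).$$
   Context: For a state (density matrix) $\rho_{XY}$ on $\mathbb{C}^d\otimes\mathbb{C}^d$ ($d\ge 2$), the negativity is $\mathcal{N}(\rho_{XY})=\dfrac{\|\rho_{XY}^{T_Y}\|_1-1}{d-1}$, where $\|\cdot\|_1$ is the trace norm and $T_Y$ denotes partial transposition on the second factor. For a pure state with Schmidt decomposition $\sum_{i=0}^{d-1}\sqrt{\lambda_i}\,|e_i\rangle|f_i\rangle$ ($\lambda_i\ge 0$, $\sum_i\lambda_i=1$, orthonormal bases $(e_i)$, $(f_i)$), this equals $\frac{2}{d-1}\sum_{i<j}\sqrt{\lambda_i\lambda_j}$. The convex-roof extended negativity (CREN) is $\mathcal{N}_c(\rho_{XY})=\min\sum_k p_k\,\mathcal{N}(|\psi_k\rangle_{XY})$ and the negativity of assistance (NoA) is $\mathcal{N}^a(\rho_{XY})=\max\sum_k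 p_k\,\mathcal{N}(|\psi_k\rangle_{XY})$, where the minimum, respectively maximum, is over all pure-state decompositions $\rho_{XY}=\sum_k p_k|\psi_k\rangle\langle\psi_k|$ (finite ensembles with $p_k\ge 0$, $\sum_k p_k=1$, $|\psi_k\rangle$ unit vectors). For a pure state, $\mathcal{N}_c=\mathcal{N}=\mathcal{N}^a$. The state $\rho_{AC}$ is regarded as a bipartite state with respect to the splitting $A|C$. The quantity $\mathcal{N}^a(\rho_{AC})$ is what is called the possible remotely-distributed entanglement onto $AC$ by joint measurement on $BD$. *)

theory Defs
  imports "HOL-Analysis.Analysis"
begin

text \<open>
  The space \<open>\<complex>\<^sup>d\<close> is \<^typ>\<open>complex ^ 'n\<close> with \<open>d = CARD('n)\<close>; the tensor product of
  the spaces with index types \<open>'a\<close> and \<open>'b\<close> has index type \<open>'a \<times> 'b\<close>.  Operators are matrices,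
  \<open>A $ i $ j\<close> being the entry in row \<open>i\<close> and column \<open>j\<close>.  The library norm of a vector is the
  usual Hilbert space norm.
\<close>

subsection \<open>Trace norm\<close>

definition conj_transpose :: "complex ^ 'n ^ 'm \<Rightarrow> complex ^ 'm ^ 'n" where
  "conj_transpose A = (\<chi> i j. cnj (A $ j $ i))"

text \<open>The library inner product on \<^typ>\<open>complex ^ 'n\<close> is the real part of the complex one, and
  \<open>\<langle>v, A v\<rangle>\<close> is real for Hermitian \<open>A\<close>.\<close>

definition pos_semidef :: "complex ^ 'n ^ 'n \<Rightarrow> bool" where
  "pos_semidef A \<longleftrightarrow> conj_transpose A = A \<and> (\<forall>v. 0 \<le> v \<bullet> (A *v v))"

text \<open>A positive semidefinite matrix has exactly one positive semidefinite square root; the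
  operator is only meant for such arguments.\<close>

definition psd_sqrt :: "complex ^ 'n ^ 'n \<Rightarrow> complex ^ 'n ^ 'n" where
  "psd_sqrt A = (THE P. pos_semidef P \<and> P ** P = A)"

definition trace_norm :: "complex ^ 'n ^ 'n \<Rightarrow> real" where
  "trace_norm X = Re (trace (psd_sqrt (conj_transpose X ** X)))"

subsection \<open>States, tensor products, partial operations\<close>

definition ketbra :: "complex ^ 'n \<Rightarrow> complex ^ 'n ^ 'n" where
  "ketbra \<psi> = (\<chi> i j. \<psi> $ i * cnj (\<psi> $ j))"

definition tensor_vec ::
  "complex ^ ('a::finite) \<Rightarrow> complex ^ ('b::finite) \<Rightarrow> complex ^ ('a \<times> 'b)" where
  "tensor_vec \<phi> \<psi> = (\<chi> p. \<phi> $ fst p * \<psi> $ snd p)"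

definition partial_transpose ::
  "complex ^ ('a::finite \<times> 'b::finite) ^ ('a \<times> 'b) \<Rightarrow> complex ^ ('a \<times> 'b) ^ ('a \<times> 'b)" where
  "partial_transpose \<rho> = (\<chi> p q. \<rho> $ (fst p, snd q) $ (fst q, snd p))"

text \<open>Partial trace over the second and the fourth factor, the four factors being grouped as
  \<open>(A \<otimes> B) \<otimes> (C \<otimes> D)\<close>.\<close>

definition partial_trace_BD ::
  "complex ^ (('a::finite \<times> 'b::finite) \<times> ('c::finite \<times> 'd::finite)) ^ (('a \<times> 'b) \<times> ('c \<times> 'd))
     \<Rightarrow> complex ^ ('a \<times> 'c) ^ ('a \<times> 'c)" where
  "partial_trace_BD \<rho> =
     (\<chi> p q. \<Sum>b\<in>UNIV. \<Sum>d\<in>UNIV.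
        \<rho> $ ((fst p, b), (snd p, d)) $ ((fst q, b), (snd q, d)))"

subsection \<open>Negativity, its convex roof, and negativity of assistance\<close>

definition negativity :: "complex ^ ('n::finite \<times> 'n) ^ ('n \<times> 'n) \<Rightarrow> real" where
  "negativity \<rho> = (trace_norm (partial_transpose \<rho>) - 1) / (real CARD('n) - 1)"

definition pure_decomposition ::
  "nat \<Rightarrow> (nat \<Rightarrow> real) \<Rightarrow> (nat \<Rightarrow> complex ^ 'n) \<Rightarrow> complex ^ 'n ^ 'n \<Rightarrow> bool" where
  "pure_decomposition m p \<psi> \<rho> \<longleftrightarrow>
     (\<forall>k<m. 0 \<le> p k \<and> norm (\<psi> k) = 1) \<and> (\<Sum>k<m. p k) = 1 \<and>
     \<rho> = (\<Sum>k<m. p k *\<^sub>R ketbra (\<psi> k))"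

definition average_negativities :: "complex ^ ('n::finite \<times> 'n) ^ ('n \<times> 'n) \<Rightarrow> real set" where
  "average_negativities \<rho> =
     {(\<Sum>k<m. p k * negativity (ketbra (\<psi> k))) | m p \<psi>. pure_decomposition m p \<psi> \<rho>}"

text \<open>For a density matrix \<open>\<rho>\<close> on \<open>\<complex>\<^sup>d \<otimes> \<complex>\<^sup>d\<close> with \<open>d \<ge> 2\<close> the set of averages is nonempty and
  bounded, and by compactness (ensembles of at most \<open>d\<^sup>4 + 1\<close> states suffice, by
  Caratheodory's theorem) both extrema are attained, so that the infimum and the supremum are the
  minimum and the maximum.\<close>

definition CREN :: "complex ^ ('n::finite \<times> 'n) ^ ('n \<times> 'n) \<Rightarrow> real" where
  "CREN \<rho> = Inf (average_negativities \<rho>)"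

definition NoA :: "complex ^ ('n::finite \<times> 'n) ^ ('n \<times> 'n) \<Rightarrow> real" where
  "NoA \<rho> = Sup (average_negativities \<rho>)"

end

theory Submission
  imports Defs "HOL-Combinatorics.Transposition"
begin

text \<open>
  Let \<open>s\<^sub>i, e\<^sub>i\<close> and \<open>t\<^sub>i, g\<^sub>i\<close> be the Schmidt coefficients and the Schmidt vectors on \<open>A\<close> and \<open>C\<close> of
  \<open>\<phi>\<close> and \<open>\<psi>\<close>, so that \<open>\<rho>\<^sub>A\<^sub>C\<close> is diagonal in the basis \<open>e\<^sub>i \<otimes> g\<^sub>j\<close> with weights \<open>s\<^sub>i\<^sup>2 t\<^sub>j\<^sup>2\<close>.
  Consider the vectors \<open>\<kappa> \<Sum>\<^sub>i \<epsilon>\<^sub>i s\<^sub>i t\<^bsub>\<pi>(i)\<^esub> e\<^sub>i \<otimes> g\<^bsub>\<pi>(i)\<^esub>\<close>, where \<open>\<pi>\<close> runs over all permutations and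
  \<open>\<epsilon>\<close> over all signs.  Averaging over the signs kills the off-diagonal terms, and averaging over the
  permutations makes the pair \<open>(i, \<pi>(i))\<close> uniform, so they form an ensemble for \<open>\<rho>\<^sub>A\<^sub>C\<close>.  They are given
  in Schmidt form, and since permutations act transitively on pairs of distinct indices, the
  average negativity is exactly \<open>\<N>(\<phi>) \<N>(\<psi>)\<close>.
\<close>

lemmas scaleR_complex = scaleR_conv_of_real [where 'a = complex]

section \<open>Complex inner products and outer products\<close>

text \<open>Antilinear in the first argument. Orthogonality over the complex numbers needs this
  form; the library inner product is only its real part.\<close>

definition cip :: "complex ^ 'n \<Rightarrow> complex ^ 'n \<Rightarrow> complex" where
  "cip u v = (\<Sum>k\<in>UNIV. cnj (u $ k) * v $ k)"

definition outer :: "complex ^ 'm \<Rightarrow> complex ^ 'n \<Rightarrow> complex ^ 'n ^ 'm" where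
  "outer u v = (\<chi> i j. u $ i * cnj (v $ j))"

lemma inner_eq_Re_cip: "u \<bullet> v = Re (cip u v)"
  by (simp add: inner_vec_def cip_def inner_complex_def)

lemma cip_self: "cip v v = of_real ((norm v)\<^sup>2)"
  by (simp add: cip_def norm_vec_def L2_set_def sum_nonneg complex_norm_square mult.commute del: of_real_power)

lemma cnj_cip: "cnj (cip u v) = cip v u"
  by (simp add: cip_def mult.commute)

lemma cip_add_left: "cip (u + v) w = cip u w + cip v w"
  and cip_add_right: "cip u (v + w) = cip u v + cip u w"
  and cip_diff_left: "cip (u - v) w = cip u w - cip v w"
  and cip_diff_right: "cip u (v - w) = cip u v - cip u w"
  and cip_minus_right: "cip u (- v) = - cip u v"
  by (simp_all add: cip_def sum.distrib sum_subtractf sum_negf algebra_simps)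

lemma cip_vscale_left: "cip (c *s u) v = cnj c * cip u v"
  and cip_vscale_right: "cip u (c *s v) = c * cip u v"
  and cip_scaleR_left: "cip (a *\<^sub>R u) v = of_real a * cip u v"
  and cip_scaleR_right: "cip u (a *\<^sub>R v) = of_real a * cip u v"
  by (simp_all add: cip_def sum_distrib_left scaleR_complex mult_ac)

lemma cip_sum_left: "cip (\<Sum>i\<in>I. f i) v = (\<Sum>i\<in>I. cip (f i) v)"
  and cip_sum_right: "cip u (\<Sum>i\<in>I. g i) = (\<Sum>i\<in>I. cip u (g i))"
  by (simp_all add: cip_def sum_distrib_left sum_distrib_right)
     (rule sum.swap)+

lemma cip_tensor: "cip (tensor_vec a b) (tensor_vec c d) = cip a c * cip b d"
  unfolding cip_def tensor_vec_def
  by (simp add: sum_product UNIV_Times_UNIV [symmetric] sum.cartesian_product mult_ac case_prod_beta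
      del: UNIV_Times_UNIV)

section \<open>Uniqueness of positive semidefinite square roots\<close>

lemma inner_matrix_vector_mult: "u \<bullet> (A *v w) = (conj_transpose A *v u) \<bullet> w"
proof -
  have "cip u (A *v w) = cip (conj_transpose A *v u) w"
    unfolding cip_def matrix_vector_mult_def conj_transpose_def
    by (simp add: sum_distrib_left sum_distrib_right mult_ac) (rule sum.swap)
  thus ?thesis by (simp add: inner_eq_Re_cip)
qed

lemma pos_semidef_selfadjoint:
  assumes "pos_semidef A"
  shows "u \<bullet> (A *v w) = (A *v u) \<bullet> w"
  using assms inner_matrix_vector_mult[of u A w] by (simp add: pos_semidef_def)

text \<open>Near \<open>t = 0\<close> the linear term dominates, so a nonzero one would change the
  sign. This is the first-order condition at an extremum, used for kernels of semidefinite forms and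
  for the maximising frame.\<close>

lemma linear_term_zero:
  fixes a b :: real
  assumes "\<And>t. 0 \<le> a * t + b * t\<^sup>2"
  shows "a = 0"
proof (rule ccontr)
  assume "a \<noteq> 0"
  \<comment> \<open>Any positive \<open>c > b\<close> makes the expression negative at
    \<open>t = - a / c\<close>.\<close>
  define c where "c = \<bar>b\<bar> + 1"
  have c: "c > 0" "b < c" by (auto simp: c_def)
  have "a * (- a / c) + b * (- a / c)\<^sup>2 = a\<^sup>2 * (b - c) / c\<^sup>2"
    using c by (simp add: field_simps power2_eq_square)
  also have "\<dots> < 0"
    using c \<open>a \<noteq> 0\<close> by (intro divide_neg_pos mult_pos_neg) auto
  finally show False using assms[of "- a / c"] by simp
qed

text \<open>The vector \<open>v\<close> minimises the quadratic form of \<open>A\<close>, so the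
  derivative in the direction \<open>A *v v\<close>, which is twice the squared norm of
  \<open>A *v v\<close>, vanishes.\<close>

lemma pos_semidef_kernel:
  assumes A: "pos_semidef A" and v: "v \<bullet> (A *v v) = 0"
  shows "A *v v = 0"
proof -
  let ?w = "A *v v"
  have "2 * (?w \<bullet> ?w) = 0"
  proof (rule linear_term_zero)
    fix t :: real
    have "0 \<le> (v + t *\<^sub>R ?w) \<bullet> (A *v (v + t *\<^sub>R ?w))"
      using A by (simp add: pos_semidef_def)
    also have "A *v (v + t *\<^sub>R ?w) = ?w + t *\<^sub>R (A *v ?w)"
      by (simp add: matrix_vector_right_distrib linear_cmul)
    also have "(v + t *\<^sub>R ?w) \<bullet> \<dots> = 2 * (?w \<bullet> ?w) * t + (?w \<bullet> (A *v ?w)) * t\<^sup>2"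
      using v pos_semidef_selfadjoint[OF A, of v ?w]
      by (simp add: inner_add_left inner_add_right power2_eq_square algebra_simps)
    finally show "0 \<le> 2 * (?w \<bullet> ?w) * t + (?w \<bullet> (A *v ?w)) * t\<^sup>2" .
  qed
  thus ?thesis by simp
qed

lemma Re_trace_eq_sum_inner:
  fixes A :: "complex ^ 'n ^ 'n"
  shows "Re (trace A) = (\<Sum>k\<in>UNIV. axis k 1 \<bullet> (A *v axis k 1))"
proof -
  have "(A *v axis k 1) $ k = A $ k $ k" for k
    by (simp add: matrix_vector_mult_def axis_def if_distrib cong: if_cong)
  thus ?thesis
    by (simp add: trace_def inner_axis' inner_complex_def)
qed

text \<open>With \<open>D = P - Q\<close> and \<open>S = P + Q\<close> one has \<open>S D = - D S\<close>, so that \<open>D S D\<close>, which is positive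
  semidefinite, has trace zero.\<close>

lemma pos_semidef_sqrt_unique:
  fixes P Q :: "complex ^ 'n ^ 'n"
  assumes P: "pos_semidef P" and Q: "pos_semidef Q" and eq: "P ** P = Q ** Q"
  shows "P = Q"
proof -
  define D S where "D = P - Q" and "S = P + Q"
  have DS: "D ** S + S ** D = 0"
    unfolding D_def S_def using eq
    by (simp add: matrix_matrix_mult_def vec_eq_iff sum.distrib sum_subtractf algebra_simps)
  have distrib: "(D ** S + S ** D) ** D = (D ** S) ** D + (S ** D) ** D"
    by (simp add: matrix_matrix_mult_def vec_eq_iff sum.distrib algebra_simps)
  have "trace (D ** (S ** D)) + trace (D ** (S ** D)) = trace ((D ** S + S ** D) ** D)"
    by (simp add: distrib trace_add matrix_mul_assoc [symmetric] trace_mul_sym[of D "S ** D"])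
  also have "\<dots> = 0"
    by (simp add: DS) (simp add: trace_def matrix_matrix_mult_def)
  finally have tr: "trace (D ** (S ** D)) = 0"
    by simp
  have Dadj: "u \<bullet> (D *v w) = (D *v u) \<bullet> w" for u w
    using pos_semidef_selfadjoint[OF P] pos_semidef_selfadjoint[OF Q]
    by (simp add: D_def matrix_vector_mult_diff_rdistrib inner_diff_left inner_diff_right)
  have Pn: "0 \<le> v \<bullet> (P *v v)" and Qn: "0 \<le> v \<bullet> (Q *v v)" for v
    using P Q by (auto simp: pos_semidef_def)
  have Sv: "v \<bullet> (S *v v) = v \<bullet> (P *v v) + v \<bullet> (Q *v v)" for v
    by (simp add: S_def matrix_vector_mult_add_rdistrib inner_add_right)
  have "(\<Sum>k\<in>UNIV. (D *v axis k 1) \<bullet> (S *v (D *v axis k 1))) = 0"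
    using tr Re_trace_eq_sum_inner[of "D ** (S ** D)"]
    by (simp add: Dadj flip: matrix_vector_mul_assoc)
  \<comment> \<open>These are the diagonal entries of \<open>D S D\<close>: nonnegative numbers with
    sum zero.\<close>
  hence z: "(D *v axis k 1) \<bullet> (S *v (D *v axis k 1)) = 0" for k
    by (subst (asm) sum_nonneg_eq_0_iff) (auto simp: Sv Pn Qn)
  have "D *v axis k 1 = 0" for k
  proof -
    let ?y = "D *v axis k 1"
    \<comment> \<open>Both forms are nonnegative and add up to zero, so \<open>P\<close> and
      \<open>Q\<close> annihilate \<open>?y\<close>. Hence \<open>D *v ?y = 0\<close>, and
      self-adjointness of \<open>D\<close> turns this into
      \<open>?y \<bullet> ?y = 0\<close>.\<close>
    have "?y \<bullet> (P *v ?y) = 0" "?y \<bullet> (Q *v ?y) = 0"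
      using z[of k] Sv[of ?y] Pn[of ?y] Qn[of ?y] by linarith+
    hence "P *v ?y = 0" "Q *v ?y = 0"
      using P Q by (auto intro: pos_semidef_kernel)
    hence "D *v ?y = 0" by (simp add: D_def matrix_vector_mult_diff_rdistrib)
    hence "?y \<bullet> ?y = 0" using Dadj[of "axis k 1" ?y] by simp
    thus ?thesis by simp
  qed
  moreover have "(D *v axis j 1) $ i = D $ i $ j" for i j
    by (simp add: matrix_vector_mult_def axis_def if_distrib cong: if_cong)
  ultimately have "D $ i $ j = 0" for i j
    by (metis zero_index)
  thus ?thesis by (simp add: D_def vec_eq_iff)
qed

lemma psd_sqrt_eqI:
  assumes "pos_semidef P" "P ** P = A"
  shows "psd_sqrt A = P"
  unfolding psd_sqrt_def using assms by (blast intro: pos_semidef_sqrt_unique)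

section \<open>Trace norm from a singular value decomposition\<close>

text \<open>Vectors of weight zero need not be normalised, so that \<open>0\<close> may fill up an incomplete system.\<close>

definition orthonormal_wrt :: "('i \<Rightarrow> real) \<Rightarrow> ('i \<Rightarrow> complex ^ 'n) \<Rightarrow> bool" where
  "orthonormal_wrt q w \<longleftrightarrow>
     (\<forall>i j. of_real (q i) * cip (w i) (w j) = (if i = j then of_real (q i) else 0))"

text \<open>The inner products of the middle vectors \<open>z\<close> collapse the double sum to its
  diagonal.\<close>

lemma outer_sum_mult:
  fixes q :: "'i::finite \<Rightarrow> real"
  assumes "orthonormal_wrt q z"
  shows "(\<Sum>i\<in>UNIV. q i *\<^sub>R outer (w i) (z i)) ** (\<Sum>j\<in>UNIV. q j *\<^sub>R outer (z j) (w' j))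
         = (\<Sum>i\<in>UNIV. (q i)\<^sup>2 *\<^sub>R outer (w i) (w' i))" (is "?A ** ?B = ?C")
proof -
  have "(?A ** ?B) $ x $ y = ?C $ x $ y" for x y
  proof -
    have "(?A ** ?B) $ x $ y = (\<Sum>k\<in>UNIV. (\<Sum>i\<in>UNIV. q i * (w i $ x * cnj (z i $ k))) *
        (\<Sum>j\<in>UNIV. q j * (z j $ k * cnj (w' j $ y))))"
      by (simp add: matrix_matrix_mult_def outer_def scaleR_complex)
    also have "\<dots> = (\<Sum>k\<in>UNIV. \<Sum>i\<in>UNIV. \<Sum>j\<in>UNIV.
        of_real (q i) * (cnj (z i $ k) * z j $ k) * (of_real (q j) * w i $ x * cnj (w' j $ y)))"
      by (simp only: sum_product) (simp add: mult_ac)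
    also have "\<dots> = (\<Sum>i\<in>UNIV. \<Sum>j\<in>UNIV. \<Sum>k\<in>UNIV.
        of_real (q i) * (cnj (z i $ k) * z j $ k) * (of_real (q j) * w i $ x * cnj (w' j $ y)))"
      by (subst sum.swap, rule sum.cong[OF refl], rule sum.swap)
    also have "\<dots> = (\<Sum>i\<in>UNIV. \<Sum>j\<in>UNIV.
        of_real (q i) * cip (z i) (z j) * (of_real (q j) * w i $ x * cnj (w' j $ y)))"
      by (simp add: cip_def sum_distrib_left sum_distrib_right)
    also have "\<dots> = (\<Sum>i\<in>UNIV. \<Sum>j\<in>UNIV.
        if j = i then of_real (q i) * (of_real (q j) * w i $ x * cnj (w' j $ y)) else 0)"
      using assms by (intro sum.cong refl) (auto simp: orthonormal_wrt_def)
    also have "\<dots> = ?C $ x $ y"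
      by (simp add: outer_def scaleR_complex power2_eq_square mult_ac)
    finally show ?thesis .
  qed
  thus ?thesis by (simp add: vec_eq_iff)
qed

lemma conj_transpose_outer_sum:
  "conj_transpose (\<Sum>i\<in>I. q i *\<^sub>R outer (z i) (w i)) = (\<Sum>i\<in>I. q i *\<^sub>R outer (w i) (z i))"
  by (simp add: conj_transpose_def outer_def vec_eq_iff scaleR_complex mult_ac)

lemma sum_matrix_vector_mult: "(\<Sum>i\<in>I. A i) *v v = (\<Sum>i\<in>I. A i *v v)"
  by (induction I rule: infinite_finite_induct) (simp_all add: matrix_vector_mult_add_rdistrib)

lemma pos_semidef_outer_sum:
  assumes "\<And>i. 0 \<le> q i"
  shows "pos_semidef (\<Sum>i\<in>I. q i *\<^sub>R outer (w i) (w i))"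
proof -
  have "0 \<le> v \<bullet> ((\<Sum>i\<in>I. q i *\<^sub>R outer (w i) (w i)) *v v)" for v
  proof -
    have "v \<bullet> ((q i *\<^sub>R outer (w i) (w i)) *v v) = q i * (cmod (cip (w i) v))\<^sup>2" for i
    proof -
      have "(q i *\<^sub>R outer (w i) (w i)) *v v = q i *\<^sub>R (cip (w i) v *s w i)"
        by (simp add: vec_eq_iff outer_def matrix_vector_mult_def cip_def scaleR_complex sum_distrib_left
            sum_distrib_right mult_ac)
      hence "v \<bullet> ((q i *\<^sub>R outer (w i) (w i)) *v v) = q i * Re (cip (w i) v * cnj (cip (w i) v))"
        by (simp add: inner_eq_Re_cip cip_scaleR_right cip_vscale_right cnj_cip)
      thus ?thesis by (simp add: complex_norm_square [symmetric] del: of_real_power)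
    qed
    thus ?thesis
      by (simp add: sum_matrix_vector_mult inner_sum_right sum_nonneg assms)
  qed
  thus ?thesis
    by (simp add: pos_semidef_def conj_transpose_outer_sum)
qed

text \<open>The sum is a singular value decomposition: its modulus is the same sum with
  \<open>z\<close> replaced by \<open>w\<close>, and the trace of that is the sum of the singular
  values.\<close>

lemma trace_norm_outer_sum:
  fixes q :: "'i::finite \<Rightarrow> real"
  assumes q: "\<And>i. 0 \<le> q i" and z: "orthonormal_wrt q z" and w: "orthonormal_wrt q w"
  shows "trace_norm (\<Sum>i\<in>UNIV. q i *\<^sub>R outer (z i) (w i)) = (\<Sum>i\<in>UNIV. q i)"
proof -
  let ?P = "\<Sum>i\<in>UNIV. q i *\<^sub>R outer (w i) (w i)"
  have "psd_sqrt (conj_transpose (\<Sum>i\<in>UNIV. q i *\<^sub>R outer (z i) (w i)) **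
      (\<Sum>i\<in>UNIV. q i *\<^sub>R outer (z i) (w i))) = ?P"
    by (rule psd_sqrt_eqI)
       (simp_all add: pos_semidef_outer_sum q conj_transpose_outer_sum outer_sum_mult z w)
  moreover have "trace ?P = (\<Sum>i\<in>UNIV. of_real (q i) * cip (w i) (w i))"
    by (simp add: trace_def outer_def cip_def scaleR_complex sum_distrib_left mult_ac)
       (rule sum.swap)
  ultimately show ?thesis
    using w by (simp add: trace_norm_def orthonormal_wrt_def)
qed

section \<open>Schmidt decompositions\<close>

text \<open>Transposing the operator \<open>outer u v\<close> gives
  \<open>outer (cnj_vec v) (cnj_vec u)\<close>; this is how conjugates enter through the partial
  transposition.\<close>

definition cnj_vec :: "complex ^ 'n \<Rightarrow> complex ^ 'n" where
  "cnj_vec v = (\<chi> i. cnj (v $ i))"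

lemma cip_cnj_vec: "cip (cnj_vec u) (cnj_vec v) = cip v u"
  by (simp add: cip_def cnj_vec_def mult.commute)

definition schmidt_form ::
  "('i::finite \<Rightarrow> real) \<Rightarrow> ('i \<Rightarrow> complex ^ 'a) \<Rightarrow> ('i \<Rightarrow> complex ^ 'b) \<Rightarrow> complex ^ ('a \<times> 'b) \<Rightarrow> bool" where
  "schmidt_form r e f \<xi> \<longleftrightarrow> (\<forall>i. 0 \<le> r i) \<and> orthonormal_wrt r e \<and> orthonormal_wrt r f \<and>
     \<xi> = (\<Sum>i\<in>UNIV. r i *\<^sub>R tensor_vec (e i) (f i))"

lemma schmidt_form_norm:
  assumes "schmidt_form r e f \<xi>"
  shows "(norm \<xi>)\<^sup>2 = (\<Sum>i\<in>UNIV. (r i)\<^sup>2)"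
proof -
  have e: "of_real (r i) * cip (e i) (e j) = (if i = j then of_real (r i) else 0)"
    and f: "of_real (r i) * cip (f i) (f j) = (if i = j then of_real (r i) else 0)" for i j
    using assms by (auto simp: schmidt_form_def orthonormal_wrt_def)
  have *: "of_real (r i) * (of_real (r j) * (cip (e i) (e j) * cip (f i) (f j))) =
      (if i = j then of_real ((r i)\<^sup>2) else 0)" for i j
  proof -
    have "of_real (r i) * (of_real (r j) * (cip (e i) (e j) * cip (f i) (f j))) =
        of_real (r j) * ((of_real (r i) * cip (e i) (e j)) * cip (f i) (f j))"
      by (simp add: mult_ac)
    also have "\<dots> = (if i = j then of_real ((r i)\<^sup>2) else 0)"
      using f[of j j] by (auto simp: e power2_eq_square)
    finally show ?thesis .
  qed
  have "of_real ((norm \<xi>)\<^sup>2) = cip \<xi> \<xi>"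
    by (simp only: cip_self)
  also have "\<dots> = (\<Sum>j\<in>UNIV. \<Sum>i\<in>UNIV.
      of_real (r i) * (of_real (r j) * (cip (e i) (e j) * cip (f i) (f j))))"
    using assms by (simp add: schmidt_form_def cip_sum_left cip_sum_right cip_scaleR_left
        cip_scaleR_right cip_tensor sum_distrib_left mult_ac)
  also have "\<dots> = of_real (\<Sum>i\<in>UNIV. (r i)\<^sup>2)"
    by (simp add: * del: of_real_power)
  finally show ?thesis by (simp only: of_real_eq_iff)
qed

text \<open>Partial transposition exchanges \<open>f i\<close> and \<open>f j\<close>, up to
  conjugation, in the term with weight \<open>r i * r j\<close>. The result is a singular value
  decomposition indexed by pairs, with singular values \<open>r i * r j\<close>.\<close>

lemma schmidt_form_trace_norm:
  assumes "schmidt_form r e f \<xi>"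
  shows "trace_norm (partial_transpose (ketbra \<xi>)) = (\<Sum>i\<in>UNIV. r i)\<^sup>2"
proof -
  have r: "0 \<le> r i" and e: "orthonormal_wrt r e" and f: "orthonormal_wrt r f" for i
    using assms by (auto simp: schmidt_form_def)
  define z where "z = (\<lambda>(i, j). tensor_vec (e i) (cnj_vec (f j)))"
  define w where "w = (\<lambda>(i, j). tensor_vec (e j) (cnj_vec (f i)))"
  define q where "q = (\<lambda>(i, j). r i * r j)"
  have ef: "of_real (r i) * of_real (r j) * (cip (e i) (e k) * cip (f l) (f j)) =
      (if i = k \<and> j = l then of_real (r i) * of_real (r j) else 0)" for i j k l
  proof -
    have "of_real (r j) * cip (f l) (f j) = cnj (of_real (r j) * cip (f j) (f l))"
      by (simp only: complex_cnj_mult complex_cnj_complex_of_real cnj_cip)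
    hence "of_real (r i) * of_real (r j) * (cip (e i) (e k) * cip (f l) (f j)) =
      (of_real (r i) * cip (e i) (e k)) * cnj (of_real (r j) * cip (f j) (f l))"
      by (simp only: mult_ac)
    moreover have "of_real (r i) * cip (e i) (e k) = (if i = k then of_real (r i) else 0)"
      and "of_real (r j) * cip (f j) (f l) = (if j = l then of_real (r j) else 0)"
      using e f by (auto simp: orthonormal_wrt_def)
    ultimately show ?thesis by (simp only:) auto
  qed
  \<comment> \<open>In \<open>w\<close> the two indices are swapped; the weight is symmetric, so
    \<open>ef\<close> applies after exchanging its factors.\<close>
  have q_commute: "q (i, j) = r j * r i" for i j
    by (simp add: q_def)
  have "orthonormal_wrt q z"
    unfolding orthonormal_wrt_def
    by (clarify, simp only: q_def z_def prod.case cip_tensor cip_cnj_vec of_real_mult ef) auto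
  moreover have "orthonormal_wrt q w"
    unfolding orthonormal_wrt_def
    by (clarify, simp only: q_commute w_def prod.case cip_tensor cip_cnj_vec of_real_mult ef) auto
  ultimately have "trace_norm (\<Sum>p\<in>UNIV. q p *\<^sub>R outer (z p) (w p)) = (\<Sum>p\<in>UNIV. q p)"
    by (intro trace_norm_outer_sum) (auto simp: q_def r)
  moreover have "partial_transpose (ketbra \<xi>) = (\<Sum>p\<in>UNIV. q p *\<^sub>R outer (z p) (w p))"
  proof -
    have "partial_transpose (ketbra \<xi>) $ x $ y = (\<Sum>p\<in>UNIV. q p *\<^sub>R outer (z p) (w p)) $ x $ y" for x y
    proof -
      have "partial_transpose (ketbra \<xi>) $ x $ y =
          (\<Sum>i\<in>UNIV. r i * (e i $ fst x * f i $ snd y)) * (\<Sum>j\<in>UNIV. r j * cnj (e j $ fst y * f j $ snd x))"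
        using assms by (simp add: schmidt_form_def partial_transpose_def ketbra_def tensor_vec_def
            scaleR_complex)
      also have "\<dots> = (\<Sum>p\<in>UNIV. q p *\<^sub>R outer (z p) (w p)) $ x $ y"
        by (simp add: sum_product UNIV_Times_UNIV [symmetric] sum.cartesian_product case_prod_beta
            q_def z_def w_def outer_def tensor_vec_def cnj_vec_def scaleR_complex mult_ac
            del: UNIV_Times_UNIV)
      finally show ?thesis .
    qed
    thus ?thesis by (simp add: vec_eq_iff)
  qed
  moreover have "(\<Sum>p\<in>UNIV. q p) = (\<Sum>i\<in>UNIV. r i)\<^sup>2"
    by (simp add: q_def power2_eq_square sum_product UNIV_Times_UNIV [symmetric] sum.cartesian_product
        del: UNIV_Times_UNIV)
  ultimately show ?thesis by simp
qed

lemma schmidt_form_reduced_state: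
  assumes "schmidt_form r e f \<xi>"
  shows "(\<Sum>b\<in>UNIV. \<xi> $ (x, b) * cnj (\<xi> $ (y, b)))
         = (\<Sum>i\<in>UNIV. of_real ((r i)\<^sup>2) * (e i $ x * cnj (e i $ y)))"
proof -
  have f: "of_real (r j) * cip (f j) (f i) = (if i = j then of_real (r i) else 0)" for i j
    using assms by (auto simp: schmidt_form_def orthonormal_wrt_def)
  have "(\<Sum>b\<in>UNIV. \<xi> $ (x, b) * cnj (\<xi> $ (y, b))) =
      (\<Sum>b\<in>UNIV. \<Sum>i\<in>UNIV. \<Sum>j\<in>UNIV.
        of_real (r i) * e i $ x * cnj (e j $ y) * (of_real (r j) * (cnj (f j $ b) * f i $ b)))"
    using assms
    by (simp add: schmidt_form_def tensor_vec_def scaleR_complex sum_product mult_ac)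
  also have "\<dots> = (\<Sum>i\<in>UNIV. \<Sum>j\<in>UNIV. \<Sum>b\<in>UNIV.
        of_real (r i) * e i $ x * cnj (e j $ y) * (of_real (r j) * (cnj (f j $ b) * f i $ b)))"
    by (subst sum.swap, rule sum.cong[OF refl], rule sum.swap)
  also have "\<dots> = (\<Sum>i\<in>UNIV. \<Sum>j\<in>UNIV.
        of_real (r i) * e i $ x * cnj (e j $ y) * (of_real (r j) * cip (f j) (f i)))"
    by (simp add: cip_def sum_distrib_left)
  also have "\<dots> = (\<Sum>i\<in>UNIV. of_real ((r i)\<^sup>2) * (e i $ x * cnj (e i $ y)))"
    by (simp add: f power2_eq_square if_distrib mult_ac cong: if_cong)
  finally show ?thesis .
qed

section \<open>Orthonormal frames as unitary matrices\<close>

definition orthonormal_frame :: "('n \<Rightarrow> complex ^ 'n) \<Rightarrow> bool" where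
  "orthonormal_frame e \<longleftrightarrow> (\<forall>i j. cip (e i) (e j) = (if i = j then 1 else 0))"

lemma orthonormal_frame_imp_wrt: "orthonormal_frame e \<Longrightarrow> orthonormal_wrt r e"
  by (simp add: orthonormal_frame_def orthonormal_wrt_def)

text \<open>The frame has as many vectors as the dimension, so its matrix is square and a one-sided
  inverse is two-sided.\<close>

lemma orthonormal_frame_complete:
  fixes e :: "'n::finite \<Rightarrow> complex ^ 'n"
  assumes "orthonormal_frame e"
  shows "(\<Sum>i\<in>UNIV. e i $ a * cnj (e i $ b)) = (if a = b then 1 else 0)"
proof -
  define V :: "complex ^ 'n ^ 'n" where "V = (\<chi> i. e i)"
  have "(V ** conj_transpose V) $ i $ j = cip (e j) (e i)" for i j
    by (simp add: V_def conj_transpose_def matrix_matrix_mult_def cip_def mult.commute)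
  hence "V ** conj_transpose V = mat 1"
    using assms by (simp add: vec_eq_iff mat_def orthonormal_frame_def)
  hence "conj_transpose V ** V = mat 1"
    by (simp add: matrix_left_right_inverse)
  hence "(conj_transpose V ** V) $ b $ a = (if a = b then 1 else 0)"
    by (auto simp: mat_def)
  thus ?thesis
    by (simp add: V_def conj_transpose_def matrix_matrix_mult_def mult.commute)
qed

text \<open>A rotation in the plane of \<open>e i\<close> and \<open>e j\<close> by an angle with
  tangent \<open>t\<close>; up to sign, \<open>c\<close> is the cosine.\<close>

lemma orthonormal_frame_rotate:
  assumes e: "orthonormal_frame e" and "i \<noteq> j" and c: "c\<^sup>2 * (1 + t\<^sup>2) = (1::real)"
  shows "orthonormal_frame (e(i := c *\<^sub>R (e i + t *\<^sub>R e j), j := c *\<^sub>R (e j - t *\<^sub>R e i)))"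
proof -
  have "of_real c * (of_real c * (1 + of_real t * of_real t)) = (of_real (c\<^sup>2 * (1 + t\<^sup>2)) :: complex)"
    by (simp add: power2_eq_square)
  hence "of_real c * (of_real c * (1 + of_real t * of_real t)) = (1::complex)"
    using c by simp
  thus ?thesis using assms(1,2)
    by (auto simp: orthonormal_frame_def cip_scaleR_left cip_scaleR_right cip_add_left cip_add_right
        cip_diff_left cip_diff_right algebra_simps)
qed

lemma orthonormal_frame_phase:
  assumes "orthonormal_frame e" and "\<And>i. cmod (u i) = 1"
  shows "orthonormal_frame (\<lambda>i. u i *s e i)"
proof -
  have "cnj (u i) * u i = 1" for i
    using assms(2)[of i] complex_norm_square[of "u i"] by (simp add: mult.commute)
  thus ?thesis using assms(1)
    by (auto simp: mult.commute orthonormal_frame_def cip_vscale_left cip_vscale_right)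
qed

text \<open>Closed, as the solution set of continuous equations, and bounded, as the rows are unit
  vectors. It provides the maximising frame below.\<close>

lemma compact_orthonormal_frames:
  "compact {V :: complex ^ 'n ^ 'n. orthonormal_frame (\<lambda>i. V $ i)}" (is "compact ?U")
proof -
  have "closed {V :: complex ^ 'n ^ 'n. \<forall>i j. (\<Sum>k\<in>UNIV. cnj (V $ i $ k) * V $ j $ k) =
      (if i = j then 1 else 0)}"
    by (intro closed_Collect_all closed_Collect_eq continuous_intros)
  hence "closed ?U"
    by (simp add: orthonormal_frame_def cip_def)
  moreover have "bounded ?U"
  proof (rule boundedI)
    fix V :: "complex ^ 'n ^ 'n" assume "V \<in> ?U"
    hence "of_real ((norm (V $ i))\<^sup>2) = (1::complex)" for i
      using cip_self[of "V $ i"] by (simp add: orthonormal_frame_def)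
    hence "(norm (V $ i))\<^sup>2 = 1" for i
      by (metis of_real_eq_1_iff)
    hence "norm (V $ i) = 1" for i
      using power2_eq_1_iff[of "norm (V $ i)"] norm_ge_zero[of "V $ i"] by force
    thus "norm V \<le> real CARD('n)"
      using norm_le_l1_cart
      by (auto simp: norm_vec_def intro!: order_trans[OF L2_set_le_sum])
  qed
  ultimately show ?thesis by (simp add: compact_eq_bounded_closed)
qed

lemma sum_remove_two:
  fixes h :: "'n::finite \<Rightarrow> 'c::ab_group_add"
  assumes "i \<noteq> j"
  shows "sum h UNIV = h i + h j + sum h (UNIV - {i, j})"
proof -
  have "sum h UNIV = sum h {i, j} + sum h (UNIV - {i, j})"
    using sum.subset_diff[of "{i, j}" UNIV h] by (simp add: add.commute)
  thus ?thesis using assms by simp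
qed

text \<open>Contracting the first factor with \<open>\<langle>v|\<close> is an antilinear map \<open>T\<close>.  An orthonormal frame
  maximising \<open>\<Sum>\<^sub>i c\<^sub>i \<parallel>T e\<^sub>i\<parallel>\<^sup>2\<close> with distinct weights \<open>c\<^sub>i\<close> is mapped to orthogonal vectors: rotating
  \<open>e\<^sub>i\<close> and \<open>e\<^sub>j\<close> by a small angle would otherwise increase the sum.\<close>

lemma schmidt_decomposition:
  fixes \<xi> :: "complex ^ ('n::finite \<times> 'b::finite)"
  obtains r :: "'n \<Rightarrow> real" and e f where "schmidt_form r e f \<xi>" "orthonormal_frame e"
proof -
  define T :: "complex ^ 'n \<Rightarrow> complex ^ 'b"
    where "T v = (\<chi> b. \<Sum>a\<in>UNIV. cnj (v $ a) * \<xi> $ (a, b))" for v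
  have T_add: "T (v + w) = T v + T w" and T_diff: "T (v - w) = T v - T w" for v w
    by (simp_all add: T_def vec_eq_iff algebra_simps sum.distrib sum_subtractf)
  have T_scaleR: "T (a *\<^sub>R v) = a *\<^sub>R T v" for a v
    by (simp add: T_def vec_eq_iff scaleR_complex sum_distrib_left mult_ac)
  have T_vscale: "T (a *s v) = cnj a *s T v" for a v
    by (simp add: T_def vec_eq_iff sum_distrib_left mult_ac)
  obtain c0 :: "'n \<Rightarrow> nat" where "inj c0"
    using finite_imp_inj_to_nat_seg[OF finite[of "UNIV :: 'n set"]] by blast
  define c where "c i = real (c0 i)" for i
  have c_neq: "c i \<noteq> c j" if "i \<noteq> j" for i j
    using that \<open>inj c0\<close> by (auto simp: c_def inj_def)
  define F where "F e = (\<Sum>i\<in>UNIV. c i * (norm (T (e i)))\<^sup>2)" for e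
  let ?U = "{V :: complex ^ 'n ^ 'n. orthonormal_frame (\<lambda>i. V $ i)}"
  have "continuous_on ?U (\<lambda>V. F (\<lambda>i. V $ i))"
    unfolding F_def T_def by (intro continuous_intros)
  moreover have "(\<chi> i. axis i 1) \<in> ?U"
    by (auto simp: orthonormal_frame_def cip_def axis_def if_distrib if_distribR cong: if_cong)
  ultimately obtain V where "V \<in> ?U" and V: "\<And>W. W \<in> ?U \<Longrightarrow> F (\<lambda>i. W $ i) \<le> F (\<lambda>i. V $ i)"
    using continuous_attains_sup[OF compact_orthonormal_frames] by (metis empty_iff)
  define e where "e = ($) V"
  have e: "orthonormal_frame e"
    using \<open>V \<in> ?U\<close> by (simp add: e_def)
  have e_max: "F e' \<le> F e" if "orthonormal_frame e'" for e'
    using V[of "\<chi> i. e' i"] that by (simp add: e_def vec_lambda_inverse)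
  \<comment> \<open>Real rotations control only the real part of the complex inner product. The
    claim covers every maximising frame so that it can be reused after a change of phase.\<close>
  have real_part: "T (e' i) \<bullet> T (e' j) = 0"
    if e': "orthonormal_frame e'" "F e' = F e" and "i \<noteq> j" for e' i j
  proof -
    let ?a = "T (e' i)" and ?b = "T (e' j)"
    have "2 * (c j - c i) * (?a \<bullet> ?b) = 0"
    proof (rule linear_term_zero)
      fix t :: real
      define k where "k = 1 / sqrt (1 + t\<^sup>2)"
      have "1 + t\<^sup>2 > 0" by (simp add: add_pos_nonneg)
      hence k: "k\<^sup>2 * (1 + t\<^sup>2) = 1"
        by (simp add: k_def power_divide)
      let ?e = "e'(i := k *\<^sub>R (e' i + t *\<^sub>R e' j), j := k *\<^sub>R (e' j - t *\<^sub>R e' i))"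
      have "F ?e \<le> F e'"
        using e_max[OF orthonormal_frame_rotate[OF e'(1) \<open>i \<noteq> j\<close> k]] e'(2) by simp
      hence le: "c i * (norm (k *\<^sub>R (?a + t *\<^sub>R ?b)))\<^sup>2 + c j * (norm (k *\<^sub>R (?b - t *\<^sub>R ?a)))\<^sup>2
          \<le> c i * (norm ?a)\<^sup>2 + c j * (norm ?b)\<^sup>2"
        using \<open>i \<noteq> j\<close> unfolding F_def sum_remove_two[OF \<open>i \<noteq> j\<close>]
        by (simp add: T_add T_diff T_scaleR)
      have n1: "(norm (k *\<^sub>R (?a + t *\<^sub>R ?b)))\<^sup>2 =
          k\<^sup>2 * ((norm ?a)\<^sup>2 + 2 * t * (?a \<bullet> ?b) + t\<^sup>2 * (norm ?b)\<^sup>2)"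
        by (simp only: power2_norm_eq_inner inner_add_left inner_add_right inner_scaleR_left
            inner_scaleR_right inner_commute [of ?b ?a]) (simp add: algebra_simps power2_eq_square)
      have n2: "(norm (k *\<^sub>R (?b - t *\<^sub>R ?a)))\<^sup>2 =
          k\<^sup>2 * ((norm ?b)\<^sup>2 - 2 * t * (?a \<bullet> ?b) + t\<^sup>2 * (norm ?a)\<^sup>2)"
        by (simp only: power2_norm_eq_inner inner_diff_left inner_diff_right inner_scaleR_left
            inner_scaleR_right inner_commute [of ?b ?a]) (simp add: algebra_simps power2_eq_square)
      \<comment> \<open>\<open>?Q\<close> is \<open>(1 + t\<^sup>2) * (F e' - F ?e)\<close>:
        clearing the denominator leaves a polynomial without constant term.\<close>
      let ?Q = "2 * (c j - c i) * (?a \<bullet> ?b) * t + ((c i - c j) * ((norm ?a)\<^sup>2 - (norm ?b)\<^sup>2)) * t\<^sup>2"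
      have "k\<^sup>2 * ?Q = k\<^sup>2 * (1 + t\<^sup>2) * (c i * (norm ?a)\<^sup>2 + c j * (norm ?b)\<^sup>2)
          - (c i * (norm (k *\<^sub>R (?a + t *\<^sub>R ?b)))\<^sup>2 + c j * (norm (k *\<^sub>R (?b - t *\<^sub>R ?a)))\<^sup>2)"
        unfolding n1 n2 by (simp add: algebra_simps)
      hence "0 \<le> k\<^sup>2 * ?Q"
        using le by (simp add: k)
      moreover have "k\<^sup>2 > 0"
        using k by (metis mult_zero_left zero_less_power2 zero_neq_one power_zero_numeral)
      ultimately show "0 \<le> ?Q"
        by (simp only: zero_le_mult_iff) linarith
    qed
    thus ?thesis using c_neq[OF \<open>i \<noteq> j\<close>] by simp
  qed
  have orth: "cip (T (e i)) (T (e j)) = 0" if "i \<noteq> j" for i j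
  proof (rule complex_eqI)
    show "Re (cip (T (e i)) (T (e j))) = Re 0"
      using real_part[OF e refl \<open>i \<noteq> j\<close>] by (simp add: inner_eq_Re_cip)
    \<comment> \<open>Multiplying \<open>e j\<close> by the imaginary unit keeps all norms, hence
      \<open>F\<close>. As \<open>T\<close> is antilinear, the real part for the new frame is the
      imaginary part for the old one.\<close>
    define u where "u k = (if k = j then \<i> else 1)" for k
    have u: "cmod (u k) = 1" for k by (simp add: u_def)
    have "norm (cnj (u k) *s v) = norm v" for k and v :: "complex ^ 'b"
      by (simp add: norm_vec_def norm_mult u)
    hence "F (\<lambda>k. u k *s e k) = F e"
      by (simp add: F_def T_vscale)
    from real_part[OF orthonormal_frame_phase[OF e u] this \<open>i \<noteq> j\<close>]
    show "Im (cip (T (e i)) (T (e j))) = Im 0"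
      using \<open>i \<noteq> j\<close> by (simp add: inner_eq_Re_cip T_vscale cip_vscale_left cip_vscale_right
          cip_minus_right u_def)
  qed
  define r where "r i = norm (T (e i))" for i
  \<comment> \<open>For \<open>r i = 0\<close> the quotient is zero by convention, so
    \<open>f i = 0\<close> is a filler, and \<open>rf\<close> survives because
    \<open>T (e i) = 0\<close>.\<close>
  define f where "f i = (1 / r i) *\<^sub>R T (e i)" for i
  have rf: "r i *\<^sub>R f i = T (e i)" for i
    by (simp add: f_def r_def)
  have "orthonormal_wrt r f"
    unfolding orthonormal_wrt_def
  proof (intro allI)
    fix i j
    have "of_real (r i) * cip (f i) (f i) = of_real (r i)"
      unfolding cip_self by (simp add: f_def r_def power2_eq_square)
    moreover have "cip (f i) (f j) = 0" if "i \<noteq> j"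
      using orth[OF that] by (simp add: f_def cip_scaleR_left cip_scaleR_right)
    ultimately show "of_real (r i) * cip (f i) (f j) = (if i = j then of_real (r i) else 0)"
      by (cases "i = j") simp_all
  qed
  \<comment> \<open>The resolution of the identity by the frame \<open>e\<close>, applied to the
    first factor of \<open>\<xi>\<close>.\<close>
  moreover have "\<xi> = (\<Sum>i\<in>UNIV. r i *\<^sub>R tensor_vec (e i) (f i))"
  proof -
    have "(\<Sum>i\<in>UNIV. r i *\<^sub>R tensor_vec (e i) (f i)) $ (a, b) = \<xi> $ (a, b)" for a b
    proof -
      have "(r i *\<^sub>R tensor_vec (e i) (f i)) $ (a, b) = e i $ a * T (e i) $ b" for i
        unfolding rf [symmetric] by (simp add: tensor_vec_def)
      hence "(\<Sum>i\<in>UNIV. r i *\<^sub>R tensor_vec (e i) (f i)) $ (a, b) =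
          (\<Sum>i\<in>UNIV. \<Sum>a'\<in>UNIV. e i $ a * cnj (e i $ a') * \<xi> $ (a', b))"
        by (simp add: T_def sum_distrib_left mult_ac)
      also have "\<dots> = (\<Sum>a'\<in>UNIV. (\<Sum>i\<in>UNIV. e i $ a * cnj (e i $ a')) * \<xi> $ (a', b))"
        by (subst sum.swap) (simp add: sum_distrib_right)
      also have "\<dots> = \<xi> $ (a, b)"
        by (simp add: orthonormal_frame_complete[OF e] if_distrib if_distribR cong: if_cong)
      finally show ?thesis .
    qed
    thus ?thesis by (simp add: vec_eq_iff split_paired_all)
  qed
  ultimately have "schmidt_form r e f \<xi>"
    by (simp add: schmidt_form_def r_def orthonormal_frame_imp_wrt[OF e])
  thus thesis using e that by blast
qed

section \<open>Averages over permutations and signs\<close>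

text \<open>By transitivity the sum over \<open>G\<close> does not depend on the starting point;
  summing it over all starting points in \<open>A\<close> and exchanging the sums gives the claim.
  The map \<open>\<tau>\<close> plays the part of translation by a group element.\<close>

lemma transitive_average:
  fixes F :: "'x \<Rightarrow> 'c::comm_semiring_1"
  assumes x: "x \<in> A"
    and perm: "\<And>g. g \<in> G \<Longrightarrow> bij_betw (act g) A A"
    and trans: "\<And>y. y \<in> A \<Longrightarrow> \<exists>\<tau>. bij_betw \<tau> G G \<and> (\<forall>g\<in>G. act (\<tau> g) x = act g y)"
  shows "of_nat (card A) * (\<Sum>g\<in>G. F (act g x)) = of_nat (card G) * (\<Sum>a\<in>A. F a)"
proof -
  have "(\<Sum>g\<in>G. F (act g y)) = (\<Sum>g\<in>G. F (act g x))" if y: "y \<in> A" for y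
  proof -
    obtain \<tau> where \<tau>: "bij_betw \<tau> G G" "\<forall>g\<in>G. act (\<tau> g) x = act g y"
      using trans[OF y] by blast
    have "(\<Sum>g\<in>G. F (act g y)) = (\<Sum>g\<in>G. F (act (\<tau> g) x))"
      using \<tau>(2) by simp
    also have "\<dots> = (\<Sum>g\<in>G. F (act g x))"
      by (rule sum.reindex_bij_betw[OF \<tau>(1)])
    finally show ?thesis .
  qed
  hence "of_nat (card A) * (\<Sum>g\<in>G. F (act g x)) = (\<Sum>y\<in>A. \<Sum>g\<in>G. F (act g y))"
    by simp
  also have "\<dots> = (\<Sum>g\<in>G. \<Sum>y\<in>A. F (act g y))"
    by (rule sum.swap)
  also have "\<dots> = (\<Sum>g\<in>G. \<Sum>a\<in>A. F a)"
    using perm by (intro sum.cong refl sum.reindex_bij_betw)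
  finally show ?thesis by simp
qed

definition permutations :: "('n \<Rightarrow> 'n) set" where
  "permutations = {\<pi>. bij \<pi>}"

definition off_diagonal :: "('n \<times> 'n) set" where
  "off_diagonal = {(i, j). i \<noteq> j}"

lemma bij_betw_permutations_comp:
  assumes "bij \<tau>"
  shows "bij_betw (\<lambda>\<pi>. \<pi> \<circ> \<tau>) permutations permutations"
proof (rule bij_betw_byWitness[where f' = "\<lambda>\<pi>. \<pi> \<circ> inv \<tau>"])
  show "\<forall>\<pi>\<in>permutations. (\<pi> \<circ> \<tau>) \<circ> inv \<tau> = \<pi>" "\<forall>\<pi>\<in>permutations. (\<pi> \<circ> inv \<tau>) \<circ> \<tau> = \<pi>"
    using assms by (auto simp: fun_eq_iff bij_is_surj surj_f_inv_f bij_is_inj)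
  show "(\<lambda>\<pi>. \<pi> \<circ> \<tau>) ` permutations \<subseteq> permutations" "(\<lambda>\<pi>. \<pi> \<circ> inv \<tau>) ` permutations \<subseteq> permutations"
    using assms by (auto simp: permutations_def intro: bij_comp bij_imp_bij_inv)
qed

lemma sum_permutations_single:
  fixes F :: "'n::finite \<Rightarrow> 'c::comm_semiring_1"
  shows "of_nat CARD('n) * (\<Sum>\<pi>\<in>permutations. F (\<pi> i))
         = of_nat (card (permutations :: ('n \<Rightarrow> 'n) set)) * (\<Sum>k\<in>UNIV. F k)"
proof (rule transitive_average)
  fix j :: 'n
  have "bij_betw (\<lambda>\<pi>. \<pi> \<circ> Transposition.transpose i j) permutations permutations"
    by (intro bij_betw_permutations_comp bij_transpose)
  thus "\<exists>\<tau>. bij_betw \<tau> permutations permutations \<and> (\<forall>\<pi>\<in>permutations. \<tau> \<pi> i = \<pi> j)"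
    by (intro exI[of _ "\<lambda>\<pi>. \<pi> \<circ> Transposition.transpose i j"]) auto
qed (auto simp: permutations_def)

lemma sum_permutations_pair:
  fixes F :: "'n::finite \<Rightarrow> 'n \<Rightarrow> 'c::comm_semiring_1"
  assumes "i \<noteq> j"
  shows "of_nat (card (off_diagonal :: ('n \<times> 'n) set)) * (\<Sum>\<pi>\<in>permutations. F (\<pi> i) (\<pi> j))
         = of_nat (card (permutations :: ('n \<Rightarrow> 'n) set)) * (\<Sum>(k, l)\<in>off_diagonal. F k l)"
proof -
  have "bij_betw (map_prod \<pi> \<pi>) off_diagonal off_diagonal" if "\<pi> \<in> permutations" for \<pi> :: "'n \<Rightarrow> 'n"
  proof (rule bij_betw_byWitness[where f' = "map_prod (inv \<pi>) (inv \<pi>)"])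
    have "bij \<pi>" using that by (simp add: permutations_def)
    thus "\<forall>p\<in>off_diagonal. map_prod (inv \<pi>) (inv \<pi>) (map_prod \<pi> \<pi> p) = p"
      "\<forall>p\<in>off_diagonal. map_prod \<pi> \<pi> (map_prod (inv \<pi>) (inv \<pi>) p) = p"
      by (auto simp: bij_is_inj bij_is_surj surj_f_inv_f)
    show "map_prod \<pi> \<pi> ` off_diagonal \<subseteq> off_diagonal"
      "map_prod (inv \<pi>) (inv \<pi>) ` off_diagonal \<subseteq> off_diagonal"
      using \<open>bij \<pi>\<close> bij_imp_bij_inv[OF \<open>bij \<pi>\<close>]
      by (auto simp: off_diagonal_def dest: bij_is_inj injD)
  qed
  moreover have "\<exists>\<tau>. bij_betw \<tau> permutations permutations \<and>
      (\<forall>\<pi>\<in>permutations. map_prod (\<tau> \<pi>) (\<tau> \<pi>) (i, j) = map_prod \<pi> \<pi> p)"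
    if "p \<in> off_diagonal" for p :: "'n \<times> 'n"
  proof -
    obtain k l where p: "p = (k, l)" by (cases p)
    hence "k \<noteq> l" using that by (simp add: off_diagonal_def)
    \<comment> \<open>The inner transposition fixes \<open>i\<close> and sends \<open>j\<close> to
      the point that the outer one sends to \<open>l\<close>; the outer one sends \<open>i\<close>
      to \<open>k\<close>.\<close>
    define \<sigma> where "\<sigma> = Transposition.transpose k i \<circ> Transposition.transpose j (Transposition.transpose k i l)"
    have "bij \<sigma>" unfolding \<sigma>_def by (intro bij_comp bij_transpose)
    moreover have "\<sigma> i = k" "\<sigma> j = l"
      using assms \<open>k \<noteq> l\<close> by (auto simp: \<sigma>_def Transposition.transpose_def)
    ultimately show ?thesis
      using bij_betw_permutations_comp[of \<sigma>]
      by (intro exI[of _ "\<lambda>\<pi>. \<pi> \<circ> \<sigma>"]) (auto simp: p)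
  qed
  moreover have "(i, j) \<in> off_diagonal"
    using assms by (simp add: off_diagonal_def)
  ultimately show ?thesis
    using transitive_average[of "(i, j)" off_diagonal permutations "\<lambda>\<pi>. map_prod \<pi> \<pi>" "\<lambda>(k, l). F k l"]
    by simp
qed

lemma card_off_diagonal:
  "card (off_diagonal :: ('n::finite \<times> 'n) set) = CARD('n) * (CARD('n) - 1)"
proof -
  have *: "(off_diagonal :: ('n \<times> 'n) set) = (SIGMA i:UNIV. UNIV - {i})"
    by (auto simp: off_diagonal_def)
  show ?thesis unfolding * by simp
qed

lemma square_sum_eq_off_diagonal:
  fixes x :: "'n::finite \<Rightarrow> real"
  shows "(\<Sum>i\<in>UNIV. x i)\<^sup>2 - (\<Sum>i\<in>UNIV. (x i)\<^sup>2) = (\<Sum>(i, j)\<in>off_diagonal. x i * x j)"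
proof -
  have "(off_diagonal :: ('n \<times> 'n) set) = (SIGMA i:UNIV. UNIV - {i})"
    by (auto simp: off_diagonal_def)
  hence "(\<Sum>(i, j)\<in>off_diagonal. x i * x j) = (\<Sum>i\<in>UNIV. \<Sum>j\<in>UNIV - {i}. x i * x j)"
    by (simp add: sum.Sigma)
  also have "\<dots> = (\<Sum>i\<in>UNIV. (\<Sum>j\<in>UNIV. x i * x j) - x i * x i)"
    by (simp add: sum_diff1)
  finally show ?thesis
    by (simp add: sum_subtractf sum_product power2_eq_square)
qed

text \<open>Coding signs by booleans makes the sign patterns a finite type, so that averages are
  sums over \<open>UNIV\<close>.\<close>

definition sign_of_bool :: "bool \<Rightarrow> real" where
  "sign_of_bool b = (if b then 1 else - 1)"

lemma sign_of_bool_square: "sign_of_bool b * sign_of_bool b = 1"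
  by (simp add: sign_of_bool_def)

text \<open>For \<open>i \<noteq> j\<close>, flipping the sign at \<open>i\<close> permutes the
  patterns and negates every summand.\<close>

lemma sum_signs:
  fixes i j :: "'n::finite"
  shows "(\<Sum>\<epsilon>\<in>UNIV. sign_of_bool (\<epsilon> i) * sign_of_bool (\<epsilon> j)) = (if i = j then real CARD('n \<Rightarrow> bool) else 0)"
proof (cases "i = j")
  case True
  thus ?thesis by (simp add: sign_of_bool_square)
next
  case False
  let ?S = "\<Sum>\<epsilon>\<in>UNIV. sign_of_bool (\<epsilon> i) * sign_of_bool (\<epsilon> j)"
  let ?flip = "\<lambda>\<epsilon> :: 'n \<Rightarrow> bool. \<epsilon>(i := \<not> \<epsilon> i)"
  have "bij ?flip"
    by (rule involuntory_imp_bij) auto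
  hence "(\<Sum>\<epsilon>\<in>UNIV. sign_of_bool (?flip \<epsilon> i) * sign_of_bool (?flip \<epsilon> j)) = ?S"
    by (rule sum.reindex_bij_betw)
  moreover have "sign_of_bool (?flip \<epsilon> i) * sign_of_bool (?flip \<epsilon> j) =
      - (sign_of_bool (\<epsilon> i) * sign_of_bool (\<epsilon> j))" for \<epsilon>
    using False by (simp add: sign_of_bool_def)
  ultimately have "- ?S = ?S"
    by (simp only: sum_negf)
  thus ?thesis using False by simp
qed

lemma sum_signs_bilinear:
  fixes A B :: "'n::finite \<Rightarrow> complex"
  shows "(\<Sum>\<epsilon>\<in>UNIV. (\<Sum>i\<in>UNIV. of_real (sign_of_bool (\<epsilon> i)) * A i) *
           (\<Sum>j\<in>UNIV. of_real (sign_of_bool (\<epsilon> j)) * B j))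
         = of_nat CARD('n \<Rightarrow> bool) * (\<Sum>i\<in>UNIV. A i * B i)"
proof -
  have "(\<Sum>\<epsilon>\<in>UNIV. (\<Sum>i\<in>UNIV. of_real (sign_of_bool (\<epsilon> i)) * A i) *
           (\<Sum>j\<in>UNIV. of_real (sign_of_bool (\<epsilon> j)) * B j)) =
      (\<Sum>\<epsilon>\<in>UNIV. \<Sum>i\<in>UNIV. \<Sum>j\<in>UNIV.
        of_real (sign_of_bool (\<epsilon> i) * sign_of_bool (\<epsilon> j)) * (A i * B j))"
    by (simp only: sum_product) (simp add: mult_ac)
  also have "\<dots> = (\<Sum>i\<in>UNIV. \<Sum>j\<in>UNIV. \<Sum>\<epsilon>\<in>UNIV.
        of_real (sign_of_bool (\<epsilon> i) * sign_of_bool (\<epsilon> j)) * (A i * B j))"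
    by (subst sum.swap, rule sum.cong[OF refl], rule sum.swap)
  also have "\<dots> = (\<Sum>i\<in>UNIV. \<Sum>j\<in>UNIV.
        of_real (\<Sum>\<epsilon>\<in>UNIV. sign_of_bool (\<epsilon> i) * sign_of_bool (\<epsilon> j)) * (A i * B j))"
    by (simp only: of_real_sum sum_distrib_right)
  also have "\<dots> = of_nat CARD('n \<Rightarrow> bool) * (\<Sum>i\<in>UNIV. A i * B i)"
    unfolding sum_signs by (simp add: if_distrib if_distribR sum_distrib_left cong: if_cong)
  finally show ?thesis .
qed

section \<open>Negativity\<close>

text \<open>The pairs are ordered, which accounts for the factor 2 in the Schmidt formula for the
  negativity.\<close>

definition pair_sum :: "('n::finite \<Rightarrow> real) \<Rightarrow> real" where
  "pair_sum r = (\<Sum>(i, j)\<in>off_diagonal. r i * r j)"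

text \<open>For a unit vector the subtracted 1 is the sum of the \<open>(r i)\<^sup>2\<close>, which
  removes the diagonal from the square of the sum.\<close>

lemma negativity_schmidt:
  fixes \<xi> :: "complex ^ ('n::finite \<times> 'n)"
  assumes "schmidt_form r e f \<xi>" and "norm \<xi> = 1"
  shows "negativity (ketbra \<xi>) = pair_sum r / (real CARD('n) - 1)"
  using schmidt_form_norm[OF assms(1)] assms(2)
  by (simp add: negativity_def pair_sum_def schmidt_form_trace_norm[OF assms(1)]
      square_sum_eq_off_diagonal [symmetric])

text \<open>These bounds make the sets of averages bounded, so that \<open>Inf\<close> and
  \<open>Sup\<close> behave as intended.\<close>

lemma negativity_bounds:
  fixes \<xi> :: "complex ^ ('n::finite \<times> 'n)"
  assumes "CARD('n) \<ge> 2" and "norm \<xi> = 1"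
  shows "0 \<le> negativity (ketbra \<xi>)" and "negativity (ketbra \<xi>) \<le> 1"
proof -
  obtain r :: "'n \<Rightarrow> real" and e f where s: "schmidt_form r e f \<xi>"
    by (rule schmidt_decomposition[of \<xi>])
  have "0 \<le> pair_sum r"
    using s unfolding pair_sum_def by (intro sum_nonneg) (auto simp: schmidt_form_def)
  thus "0 \<le> negativity (ketbra \<xi>)"
    using assms(1) by (simp add: negativity_schmidt[OF s assms(2)])
  have "(\<Sum>i\<in>UNIV. (r i)\<^sup>2) = 1"
    using schmidt_form_norm[OF s] assms(2) by simp
  \<comment> \<open>Cauchy-Schwarz against the constant vector 1.\<close>
  moreover from this have "(\<Sum>i\<in>UNIV. r i)\<^sup>2 \<le> real CARD('n)"
    using sum_squared_le_sum_of_squares[of r UNIV] by simp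
  ultimately have "pair_sum r \<le> real CARD('n) - 1"
    using square_sum_eq_off_diagonal[of r] by (simp add: pair_sum_def)
  thus "negativity (ketbra \<xi>) \<le> 1"
    using assms(1) by (simp add: negativity_schmidt[OF s assms(2)])
qed

section \<open>Averages over pure-state ensembles\<close>

lemma average_negativities_bounds:
  fixes \<rho> :: "complex ^ ('n::finite \<times> 'n) ^ ('n \<times> 'n)"
  assumes "CARD('n) \<ge> 2" and "x \<in> average_negativities \<rho>"
  shows "0 \<le> x" and "x \<le> 1"
proof -
  obtain m p and \<psi> :: "nat \<Rightarrow> complex ^ ('n \<times> 'n)" where
    x: "x = (\<Sum>k<m. p k * negativity (ketbra (\<psi> k)))" and "pure_decomposition m p \<psi> \<rho>"
    using assms(2) by (auto simp: average_negativities_def)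
  hence p: "0 \<le> p k" "norm (\<psi> k) = 1" if "k < m" for k
    using that by (auto simp: pure_decomposition_def)
  have sum_p: "(\<Sum>k<m. p k) = 1"
    using \<open>pure_decomposition m p \<psi> \<rho>\<close> by (simp add: pure_decomposition_def)
  show "0 \<le> x"
    unfolding x using p negativity_bounds(1)[OF assms(1)] by (intro sum_nonneg mult_nonneg_nonneg) auto
  have "x \<le> (\<Sum>k<m. p k * 1)"
    unfolding x using p negativity_bounds(2)[OF assms(1)] by (intro sum_mono mult_left_mono) auto
  thus "x \<le> 1" by (simp add: sum_p)
qed

lemma negativity_in_average_negativities:
  assumes "norm \<xi> = 1"
  shows "negativity (ketbra \<xi>) \<in> average_negativities (ketbra \<xi>)"
  unfolding average_negativities_def pure_decomposition_def mem_Collect_eq using assms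
  by (intro exI[of _ 1] exI[of _ "\<lambda>_. 1"] exI[of _ "\<lambda>_. \<xi>"]) simp

text \<open>The ensemble with one member makes the set of averages nonempty and bounds its infimum
  from above.\<close>

lemma CREN_ketbra_bounds:
  fixes \<xi> :: "complex ^ ('n::finite \<times> 'n)"
  assumes "CARD('n) \<ge> 2" and "norm \<xi> = 1"
  shows "0 \<le> CREN (ketbra \<xi>)" and "CREN (ketbra \<xi>) \<le> negativity (ketbra \<xi>)"
proof -
  show "0 \<le> CREN (ketbra \<xi>)"
    unfolding CREN_def
    using negativity_in_average_negativities[OF assms(2)] average_negativities_bounds(1)[OF assms(1)]
    by (intro cInf_greatest) auto
  show "CREN (ketbra \<xi>) \<le> negativity (ketbra \<xi>)"
    unfolding CREN_def
    using negativity_in_average_negativities[OF assms(2)] average_negativities_bounds(1)[OF assms(1)]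
    by (intro cInf_lower bdd_belowI) auto
qed

lemma orthonormal_wrt_scale:
  assumes "orthonormal_wrt r e"
  shows "orthonormal_wrt (\<lambda>i. c * r i) e"
  unfolding orthonormal_wrt_def
proof (intro allI)
  fix i j
  have "of_real (r i) * cip (e i) (e j) = (if i = j then of_real (r i) else 0)"
    using assms by (simp only: orthonormal_wrt_def)
  thus "of_real (c * r i) * cip (e i) (e j) = (if i = j then of_real (c * r i) else 0)"
    by (simp only: of_real_mult mult.assoc) simp
qed

lemma schmidt_form_scale:
  assumes "schmidt_form r e f \<xi>" and "0 < c"
  shows "schmidt_form (\<lambda>i. c * r i) e f (c *\<^sub>R \<xi>)"
  using assms by (simp add: schmidt_form_def orthonormal_wrt_scale scaleR_sum_right)

text \<open>The members of the ensemble are the normalised vectors \<open>\<xi> k\<close>; a vector \<open>\<xi> k = 0\<close> has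
  probability zero and is replaced by an arbitrary unit vector.\<close>

lemma ensemble_average_negativity:
  fixes \<xi> :: "'k \<Rightarrow> complex ^ ('n::finite \<times> 'n)"
  assumes "finite K"
    and s: "\<And>k. k \<in> K \<Longrightarrow> schmidt_form (r k) (e k) (f k) (\<xi> k)"
    and \<rho>: "(\<Sum>k\<in>K. ketbra (\<xi> k)) = \<rho>"
    and norm_1: "(\<Sum>k\<in>K. (norm (\<xi> k))\<^sup>2) = 1"
  shows "(\<Sum>k\<in>K. pair_sum (r k) / (real CARD('n) - 1)) \<in> average_negativities \<rho>"
proof -
  define p where "p k = (norm (\<xi> k))\<^sup>2" for k
  define \<psi> where "\<psi> k = (if \<xi> k = 0 then axis undefined 1 else (1 / norm (\<xi> k)) *\<^sub>R \<xi> k)" for k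
  have p\<psi>: "p k *\<^sub>R ketbra (\<psi> k) = ketbra (\<xi> k)" for k
    by (simp add: p_def \<psi>_def ketbra_def vec_eq_iff scaleR_complex power2_eq_square)
  have norm_\<psi>: "norm (\<psi> k) = 1" for k
    by (simp add: \<psi>_def norm_eq_sqrt_inner [of "axis _ _"] inner_axis_axis)
  have neg: "p k * negativity (ketbra (\<psi> k)) = pair_sum (r k) / (real CARD('n) - 1)" if "k \<in> K" for k
  proof (cases "\<xi> k = 0")
    case True
    hence "(\<Sum>i\<in>UNIV. (r k i)\<^sup>2) = 0"
      using schmidt_form_norm[OF s[OF that]] by simp
    hence "r k i = 0" for i
      by (subst (asm) sum_nonneg_eq_0_iff) auto
    thus ?thesis using True by (simp add: p_def pair_sum_def case_prod_beta)
  next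
    case False
    let ?c = "1 / norm (\<xi> k)"
    have "schmidt_form (\<lambda>i. ?c * r k i) (e k) (f k) (\<psi> k)"
      using schmidt_form_scale[OF s[OF that], of ?c] False by (simp add: \<psi>_def)
    from negativity_schmidt[OF this norm_\<psi>]
    have "negativity (ketbra (\<psi> k)) = pair_sum (\<lambda>i. ?c * r k i) / (real CARD('n) - 1)" .
    \<comment> \<open>\<open>pair_sum\<close> is quadratic, so the normalisation contributes
      \<open>?c\<^sup>2\<close>, which cancels against \<open>p k\<close>.\<close>
    moreover have "pair_sum (\<lambda>i. ?c * r k i) = ?c\<^sup>2 * pair_sum (r k)"
      by (simp add: pair_sum_def sum_distrib_left case_prod_beta power2_eq_square)
    ultimately show ?thesis using False by (simp add: p_def power_divide)
  qed
  obtain h where h: "bij_betw h {..<card K} K"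
    using ex_bij_betw_nat_finite[OF \<open>finite K\<close>] by (auto simp: atLeast0LessThan)
  have "pure_decomposition (card K) (p \<circ> h) (\<psi> \<circ> h) \<rho>"
    using norm_1 \<rho> sum.reindex_bij_betw[OF h, of p] sum.reindex_bij_betw[OF h, of "\<lambda>k. ketbra (\<xi> k)"]
    by (simp add: pure_decomposition_def norm_\<psi> p\<psi>) (simp add: p_def)
  moreover have "(\<Sum>k\<in>K. pair_sum (r k) / (real CARD('n) - 1)) =
      (\<Sum>k<card K. (p \<circ> h) k * negativity (ketbra ((\<psi> \<circ> h) k)))"
    using sum.reindex_bij_betw[OF h, of "\<lambda>k. p k * negativity (ketbra (\<psi> k))"] by (simp add: neg)
  ultimately show ?thesis
    unfolding average_negativities_def by blast
qed

section \<open>The ensemble for the reduced state on \<open>AC\<close>\<close>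

lemma partial_trace_product:
  "partial_trace_BD (ketbra (tensor_vec \<phi> \<psi>)) $ x $ y =
     (\<Sum>b\<in>UNIV. \<phi> $ (fst x, b) * cnj (\<phi> $ (fst y, b))) *
     (\<Sum>d\<in>UNIV. \<psi> $ (snd x, d) * cnj (\<psi> $ (snd y, d)))"
  by (simp add: partial_trace_BD_def ketbra_def tensor_vec_def sum_product mult_ac)

lemma negativity_product_in_average_negativities:
  fixes \<phi> \<psi> :: "complex ^ ('n::finite \<times> 'n)"
  assumes d: "CARD('n) \<ge> 2" and "norm \<phi> = 1" and "norm \<psi> = 1"
  shows "negativity (ketbra \<phi>) * negativity (ketbra \<psi>)
         \<in> average_negativities (partial_trace_BD (ketbra (tensor_vec \<phi> \<psi>)))"
proof -
  obtain s :: "'n \<Rightarrow> real" and e f where s: "schmidt_form s e f \<phi>" and e: "orthonormal_frame e"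
    by (rule schmidt_decomposition[of \<phi>])
  obtain t :: "'n \<Rightarrow> real" and g h where t: "schmidt_form t g h \<psi>" and g: "orthonormal_frame g"
    by (rule schmidt_decomposition[of \<psi>])
  have s0: "0 \<le> s i" and t0: "0 \<le> t i" for i
    using s t by (auto simp: schmidt_form_def)
  define N where "N = card (permutations :: ('n \<Rightarrow> 'n) set)"
  define M where "M = CARD('n \<Rightarrow> bool)"
  \<comment> \<open>A given pair \<open>(i, k)\<close> satisfies \<open>\<pi> i = k\<close> for
    \<open>N / CARD('n)\<close> permutations, each with \<open>M\<close> sign patterns;
    \<open>\<kappa>\<^sup>2\<close> is the inverse of this count.\<close>
  define \<kappa> where "\<kappa> = sqrt (real CARD('n) / (real N * real M))"
  have "(id :: 'n \<Rightarrow> 'n) \<in> permutations"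
    by (simp add: permutations_def)
  hence "N > 0"
    by (auto simp: N_def card_gt_0_iff)
  have "M > 0" by (simp add: M_def)
  have \<kappa>2: "\<kappa>\<^sup>2 = real CARD('n) / (real N * real M)"
    by (simp add: \<kappa>_def)
  have "\<kappa> \<ge> 0" by (simp add: \<kappa>_def)
  have single: "\<kappa>\<^sup>2 * real M * (\<Sum>\<pi>\<in>permutations. F (\<pi> i)) = (\<Sum>k\<in>UNIV. F k)"
    for F :: "'n \<Rightarrow> real" and i
    using sum_permutations_single[of F i] \<open>N > 0\<close> \<open>M > 0\<close>
    unfolding \<kappa>2 N_def [symmetric] by (simp add: field_simps)
  have single_c: "of_real (\<kappa>\<^sup>2 * real M) * (\<Sum>\<pi>\<in>permutations. F (\<pi> i)) = (\<Sum>k\<in>UNIV. F k)"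
    for F :: "'n \<Rightarrow> complex" and i
    using sum_permutations_single[of F i] \<open>N > 0\<close> \<open>M > 0\<close>
    unfolding \<kappa>2 N_def [symmetric] by (simp add: field_simps)
  \<comment> \<open>There are \<open>CARD('n) * (CARD('n) - 1)\<close> ordered pairs of distinct
    indices. The first factor cancels against \<open>\<kappa>\<^sup>2\<close>; the second is the
    denominator of the negativity of \<open>\<psi>\<close>.\<close>
  have pair: "\<kappa>\<^sup>2 * real M * (\<Sum>\<pi>\<in>permutations. t (\<pi> i) * t (\<pi> j)) = pair_sum t / (real CARD('n) - 1)"
    if "i \<noteq> j" for i j
  proof -
    have "real (card (off_diagonal :: ('n \<times> 'n) set)) = real CARD('n) * (real CARD('n) - 1)"
      using d by (simp add: card_off_diagonal of_nat_diff)
    with sum_permutations_pair[OF that, of "\<lambda>k l. t k * t l"]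
    have "real CARD('n) * (real CARD('n) - 1) * (\<Sum>\<pi>\<in>permutations. t (\<pi> i) * t (\<pi> j)) =
        real N * pair_sum t"
      by (simp add: N_def pair_sum_def)
    thus ?thesis
      using \<open>N > 0\<close> \<open>M > 0\<close> d unfolding \<kappa>2 by (simp add: field_simps)
  qed

  define K where "K = (permutations :: ('n \<Rightarrow> 'n) set) \<times> (UNIV :: ('n \<Rightarrow> bool) set)"
  define r where "r = (\<lambda>(\<pi> :: 'n \<Rightarrow> 'n, \<epsilon> :: 'n \<Rightarrow> bool) i. \<kappa> * (s i * t (\<pi> i)))"
  \<comment> \<open>The signs are absorbed into the vectors, since the Schmidt weights
    \<open>r\<close> must be nonnegative.\<close>
  define e' where "e' = (\<lambda>(\<pi> :: 'n \<Rightarrow> 'n, \<epsilon>) i. of_real (sign_of_bool (\<epsilon> i)) *s e i)"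
  define g' where "g' = (\<lambda>(\<pi> :: 'n \<Rightarrow> 'n, \<epsilon> :: 'n \<Rightarrow> bool) i. g (\<pi> i))"
  define \<xi> where "\<xi> k = (\<Sum>i\<in>UNIV. r k i *\<^sub>R tensor_vec (e' k i) (g' k i))" for k
  have sum_K: "(\<Sum>k\<in>K. F k) = (\<Sum>\<pi>\<in>permutations. \<Sum>\<epsilon>\<in>UNIV. F (\<pi>, \<epsilon>))"
    for F :: "('n \<Rightarrow> 'n) \<times> ('n \<Rightarrow> bool) \<Rightarrow> 'c::comm_monoid_add"
    by (simp add: K_def sum.cartesian_product)
  have schmidt: "schmidt_form (r k) (e' k) (g' k) (\<xi> k)" if "k \<in> K" for k
  proof -
    obtain \<pi> \<epsilon> where k: "k = (\<pi>, \<epsilon>)" by (cases k)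
    hence "bij \<pi>" using that by (simp add: K_def permutations_def)
    have "orthonormal_frame (e' k)"
      using orthonormal_frame_phase[OF e, of "\<lambda>i. of_real (sign_of_bool (\<epsilon> i))"]
      by (simp add: k e'_def sign_of_bool_def)
    moreover have "orthonormal_frame (g' k)"
      using g bij_is_inj[OF \<open>bij \<pi>\<close>] by (auto simp: k g'_def orthonormal_frame_def inj_eq)
    moreover have "0 \<le> r k i" for i
      using s0 t0 \<open>\<kappa> \<ge> 0\<close> by (simp add: k r_def)
    ultimately show ?thesis
      by (simp add: schmidt_form_def \<xi>_def orthonormal_frame_imp_wrt)
  qed

  have "(\<Sum>k\<in>K. (norm (\<xi> k))\<^sup>2) = (\<Sum>k\<in>K. \<Sum>i\<in>UNIV. (r k i)\<^sup>2)"
    by (intro sum.cong refl schmidt_form_norm[OF schmidt])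
  also have "\<dots> = (\<Sum>\<pi>\<in>permutations. \<Sum>i\<in>UNIV. \<kappa>\<^sup>2 * real M * ((s i)\<^sup>2 * (t (\<pi> i))\<^sup>2))"
    by (simp add: sum_K r_def M_def power_mult_distrib sum_distrib_left mult_ac)
  also have "\<dots> = (\<Sum>i\<in>UNIV. (s i)\<^sup>2 * (\<kappa>\<^sup>2 * real M * (\<Sum>\<pi>\<in>permutations. (t (\<pi> i))\<^sup>2)))"
    by (subst sum.swap) (simp add: sum_distrib_left mult_ac)
  also have "\<dots> = (\<Sum>i\<in>UNIV. (s i)\<^sup>2) * (\<Sum>k\<in>UNIV. (t k)\<^sup>2)"
    by (simp only: single[where F = "\<lambda>k. (t k)\<^sup>2"] sum_distrib_right)
  also have "\<dots> = 1"
    using schmidt_form_norm[OF s] schmidt_form_norm[OF t] assms(2,3) by simp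
  finally have norm_1: "(\<Sum>k\<in>K. (norm (\<xi> k))\<^sup>2) = 1" .

  have "(\<Sum>k\<in>K. ketbra (\<xi> k)) $ x $ y = partial_trace_BD (ketbra (tensor_vec \<phi> \<psi>)) $ x $ y" for x y
  proof -
    \<comment> \<open>The sums of \<open>a\<close> and \<open>b\<close> are entries of the two
      reduced states; \<open>A\<close> is an amplitude of \<open>\<xi>\<close> with the sign taken
      out.\<close>
    define a where "a i = of_real ((s i)\<^sup>2) * (e i $ fst x * cnj (e i $ fst y))" for i
    define b where "b i = of_real ((t i)\<^sup>2) * (g i $ snd x * cnj (g i $ snd y))" for i
    define A where "A \<pi> i z = of_real (\<kappa> * (s i * t (\<pi> i))) * (e i $ fst z * g (\<pi> i) $ snd z)"
      for \<pi> i and z :: "'n \<times> 'n"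
    have \<xi>: "\<xi> (\<pi>, \<epsilon>) $ z = (\<Sum>i\<in>UNIV. of_real (sign_of_bool (\<epsilon> i)) * A \<pi> i z)" for \<pi> \<epsilon> z
      by (simp add: \<xi>_def r_def e'_def g'_def A_def tensor_vec_def scaleR_complex mult_ac)
    have "(\<Sum>k\<in>K. ketbra (\<xi> k)) $ x $ y = (\<Sum>k\<in>K. \<xi> k $ x * cnj (\<xi> k $ y))"
      by (simp add: ketbra_def)
    also have "\<dots> = (\<Sum>\<pi>\<in>permutations. \<Sum>\<epsilon>\<in>UNIV. \<xi> (\<pi>, \<epsilon>) $ x * cnj (\<xi> (\<pi>, \<epsilon>) $ y))"
      by (rule sum_K)
    also have "\<dots> = (\<Sum>\<pi>\<in>permutations. \<Sum>\<epsilon>\<in>UNIV.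
        (\<Sum>i\<in>UNIV. of_real (sign_of_bool (\<epsilon> i)) * A \<pi> i x) *
        (\<Sum>i\<in>UNIV. of_real (sign_of_bool (\<epsilon> i)) * cnj (A \<pi> i y)))"
      by (simp add: \<xi>)
    also have "\<dots> = (\<Sum>\<pi>\<in>permutations. of_nat M * (\<Sum>i\<in>UNIV. A \<pi> i x * cnj (A \<pi> i y)))"
      by (simp only: sum_signs_bilinear M_def)
    also have "\<dots> = (\<Sum>\<pi>\<in>permutations. \<Sum>i\<in>UNIV. of_real (\<kappa>\<^sup>2 * real M) * (a i * b (\<pi> i)))"
      by (simp add: A_def a_def b_def sum_distrib_left power2_eq_square mult_ac)
    also have "\<dots> = (\<Sum>i\<in>UNIV. a i * (of_real (\<kappa>\<^sup>2 * real M) * (\<Sum>\<pi>\<in>permutations. b (\<pi> i))))"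
      by (subst sum.swap) (simp add: sum_distrib_left sum_distrib_right mult_ac)
    also have "\<dots> = (\<Sum>i\<in>UNIV. a i) * (\<Sum>k\<in>UNIV. b k)"
      by (simp only: single_c sum_distrib_right)
    \<comment> \<open>For a product vector the partial trace factorises into the reduced states,
      each diagonal in its Schmidt vectors.\<close>
    also have "\<dots> = partial_trace_BD (ketbra (tensor_vec \<phi> \<psi>)) $ x $ y"
      unfolding partial_trace_product a_def b_def schmidt_form_reduced_state[OF s]
        schmidt_form_reduced_state[OF t] ..
    finally show ?thesis .
  qed
  hence \<rho>: "(\<Sum>k\<in>K. ketbra (\<xi> k)) = partial_trace_BD (ketbra (tensor_vec \<phi> \<psi>))"
    by (simp add: vec_eq_iff)

  have "finite K" by simp
  from ensemble_average_negativity[OF this schmidt \<rho> norm_1]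
  have "(\<Sum>k\<in>K. pair_sum (r k) / (real CARD('n) - 1))
      \<in> average_negativities (partial_trace_BD (ketbra (tensor_vec \<phi> \<psi>)))" .
  \<comment> \<open>The weights do not depend on the signs, so the sign sum is the factor
    \<open>M\<close>; the permutation sum is then evaluated by \<open>pair\<close> for each
    \<open>i \<noteq> j\<close>.\<close>
  moreover have "(\<Sum>k\<in>K. pair_sum (r k)) = pair_sum s * (pair_sum t / (real CARD('n) - 1))"
  proof -
    have "(\<Sum>k\<in>K. pair_sum (r k)) = (\<Sum>\<pi>\<in>permutations. \<Sum>(i, j)\<in>off_diagonal.
        \<kappa>\<^sup>2 * real M * (s i * s j * (t (\<pi> i) * t (\<pi> j))))"
      by (simp add: sum_K r_def pair_sum_def M_def case_prod_beta sum_distrib_left power2_eq_square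
          mult_ac)
    also have "\<dots> = (\<Sum>(i, j)\<in>off_diagonal. s i * s j *
        (\<kappa>\<^sup>2 * real M * (\<Sum>\<pi>\<in>permutations. t (\<pi> i) * t (\<pi> j))))"
      by (subst sum.swap) (simp add: case_prod_beta sum_distrib_left mult_ac)
    also have "\<dots> = (\<Sum>(i, j)\<in>off_diagonal. s i * s j * (pair_sum t / (real CARD('n) - 1)))"
      by (intro sum.cong refl) (auto simp: off_diagonal_def pair)
    also have "\<dots> = pair_sum s * (pair_sum t / (real CARD('n) - 1))"
      unfolding pair_sum_def [of s] by (simp only: sum_distrib_right split_def)
    finally show ?thesis .
  qed
  ultimately show ?thesis
    by (simp add: negativity_schmidt[OF s assms(2)] negativity_schmidt[OF t assms(3)]
        sum_divide_distrib [symmetric])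
qed

theorem theorem1:
  fixes \<phi> \<psi> :: "complex ^ ('n::finite \<times> 'n)"
  assumes "CARD('n) \<in> {2, 3}"
    and "norm \<phi> = 1"
    and "norm \<psi> = 1"
  shows "NoA (partial_trace_BD (ketbra (tensor_vec \<phi> \<psi>))) \<ge> CREN (ketbra \<phi>) * CREN (ketbra \<psi>)"
proof -
  have d: "CARD('n) \<ge> 2" using assms(1) by auto
  \<comment> \<open>Nonnegativity of the convex roofs allows the two bounds by the negativities to
    be multiplied.\<close>
  have "CREN (ketbra \<phi>) * CREN (ketbra \<psi>) \<le> negativity (ketbra \<phi>) * negativity (ketbra \<psi>)"
    using CREN_ketbra_bounds[OF d assms(2)] CREN_ketbra_bounds[OF d assms(3)]
    by (intro mult_mono) auto
  also have "\<dots> \<le> NoA (partial_trace_BD (ketbra (tensor_vec \<phi> \<psi>)))"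
    unfolding NoA_def
    using negativity_product_in_average_negativities[OF d assms(2,3)] average_negativities_bounds(2)[OF d]
    by (intro cSup_upper bdd_aboveI) auto
  finally show ?thesis .
qed

end
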